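(* Let $L$ be a frame and let $e\colon L\to L^\delta$ be a canonical extension of $L$. Define $e^{\wedge}\colon L^{\wedge}\to L^\delta$ by $e^{\wedge}(\kappa)=\bigwedge e[\kappa]=\bigwedge\{e(a)\mid a\in\kappa\}$. Then: (1) $e$ is a preframe homomorphism preserving $0$. (2) $e^{\wedge}\colon L^{\wedge}\to L^\delta$ is an injective co-preframe homomorphism (where $L^{\wedge}$ is ordered by reverse inclusion), i.e. it preserves finite joins and filtered meets. (3) For every $u\in L^\delta$, $u=\bigwedge\{e(a)\mid a\in L,\ u\le e(a)\}$ and $u=\bigvee\{e^{\wedge}(\kappa)\mid \kappa\in L^{\wedge},\ e^{\wedge}(\kappa)\le u\}$. (4) If $e$ is injective, then it is a frame homomorphism, i.e. it preserves arbitrary joins and finite meets. (5) If $L$ is locally compact, then $e$ is an injective frame homomorphism.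
   Context: A frame is a complete lattice $L$ satisfying $(\bigvee A)\wedge b=\bigvee_{a\in A}(a\wedge b)$ for all $A\subseteq L$, $b\in L$. A preframe homomorphism is a map preserving directed joins and finite meets (including the top). For $a,c\in L$, $c\ll a$ means: for every directed $D\subseteq L$, $a\le\bigvee D$ implies $c\le d$ for some $d\in D$. $L$ is locally compact if $a=\bigvee\{c\mid c\ll a\}$, a directed join, for every $a\in L$. A filter of $L$ is an upset closed under finite meets (so it contains $1$; the improper filter $L$ is allowed). A filter $\kappa\subseteq L$ is Scott-open if, whenever $D\subseteq L$ is directed and $\bigvee D\in\kappa$, then $d\in\kappa$ for some $d\in D$. $L^{\wedge}$ denotes the set of Scott-open filters of $L$ ordered by reverse inclusion; in it, the bottom is $L$ itself, binary joins are intersections, and filtered meets are directed unions. A canonical extension of $L$ is a monotone map $e\colon L\to L^\delta$ into a complete lattice $L^\delta$ (not assumed distributive) such that: (Dense) for all $u,v\in L^\delta$: $u\le v$ holds provided that for all $\kappa\in L^{\wedge}$ and $a\in L$, the inequalities $\bigwedge e[\kappa]\le u$ and $v\le e(a)$ together imply $\bigwedge e[\kappa]\le e(a)$; (Compact) if $\bigwedge e[\kappa]\le e(a)$ for some $\kappa\in L^{\wedge}$ and $a\in L$, then $a\in\kappa$. *)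

theory Defs
  imports Complex_Main "HOL-Library.Lub_Glb"
begin

text \<open>
  The library class \<open>complete_distrib_lattice\<close> is \<^emph>\<open>complete\<close> distributivity and hence
  strictly stronger than the frame law.
\<close>

class frame = complete_lattice +
  assumes Sup_inf_frame: "inf (Sup A) b = (SUP a\<in>A. inf a b)"

definition directed :: "'a::order set \<Rightarrow> bool" where
  "directed D \<longleftrightarrow> D \<noteq> {} \<and> (\<forall>x\<in>D. \<forall>y\<in>D. \<exists>z\<in>D. x \<le> z \<and> y \<le> z)"

definition filtered :: "'a::order set \<Rightarrow> bool" where
  "filtered D \<longleftrightarrow> D \<noteq> {} \<and> (\<forall>x\<in>D. \<forall>y\<in>D. \<exists>z\<in>D. z \<le> x \<and> z \<le> y)"

definition way_below :: "'a::complete_lattice \<Rightarrow> 'a \<Rightarrow> bool" where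
  "way_below c a \<longleftrightarrow> (\<forall>D. directed D \<longrightarrow> a \<le> Sup D \<longrightarrow> (\<exists>d\<in>D. c \<le> d))"

definition locally_compact_frame :: "'a::frame itself \<Rightarrow> bool" where
  "locally_compact_frame _ \<longleftrightarrow>
     (\<forall>a::'a. directed {c. way_below c a} \<and> a = Sup {c. way_below c a})"

definition preframe_hom :: "('a::complete_lattice \<Rightarrow> 'b::complete_lattice) \<Rightarrow> bool" where
  "preframe_hom f \<longleftrightarrow>
     (\<forall>D. directed D \<longrightarrow> f (Sup D) = Sup (f ` D)) \<and>
     (\<forall>A. finite A \<longrightarrow> f (Inf A) = Inf (f ` A))"

definition frame_hom :: "('a::complete_lattice \<Rightarrow> 'b::complete_lattice) \<Rightarrow> bool" where
  "frame_hom f \<longleftrightarrow>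
     (\<forall>A. f (Sup A) = Sup (f ` A)) \<and>
     (\<forall>A. finite A \<longrightarrow> f (Inf A) = Inf (f ` A))"

text \<open>
  The domain is only a poset, so its joins and meets are taken relationally.
\<close>

definition co_preframe_hom :: "('a::order \<Rightarrow> 'b::complete_lattice) \<Rightarrow> bool" where
  "co_preframe_hom f \<longleftrightarrow>
     (\<forall>A x. finite A \<longrightarrow> isLub UNIV A x \<longrightarrow> f x = Sup (f ` A)) \<and>
     (\<forall>A x. filtered A \<longrightarrow> isGlb UNIV A x \<longrightarrow> f x = Inf (f ` A))"

text \<open>
  The case \<open>A = {}\<close> of the second condition is \<open>top \<in> K\<close>; the improper filter \<open>UNIV\<close> is allowed.
\<close>

definition lattice_filter :: "'a::complete_lattice set \<Rightarrow> bool" where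
  "lattice_filter K \<longleftrightarrow>
     (\<forall>x\<in>K. \<forall>y. x \<le> y \<longrightarrow> y \<in> K) \<and>
     (\<forall>A. finite A \<longrightarrow> A \<subseteq> K \<longrightarrow> Inf A \<in> K)"

definition scott_open_filter :: "'a::complete_lattice set \<Rightarrow> bool" where
  "scott_open_filter K \<longleftrightarrow>
     lattice_filter K \<and> (\<forall>D. directed D \<longrightarrow> Sup D \<in> K \<longrightarrow> (\<exists>d\<in>D. d \<in> K))"

lemma lattice_filterD: "lattice_filter K \<Longrightarrow> x \<in> K \<Longrightarrow> x \<le> y \<Longrightarrow> y \<in> K"
  unfolding lattice_filter_def by blast

lemma scott_open_filter_UNIV: "scott_open_filter UNIV"
  unfolding scott_open_filter_def lattice_filter_def directed_def by auto

lemma scott_open_filter_Int: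
  assumes "scott_open_filter K" "scott_open_filter M"
  shows "scott_open_filter (K \<inter> M)"
proof -
  have "\<exists>d\<in>D. d \<in> K \<inter> M" if D: "directed D" "Sup D \<in> K \<inter> M" for D
  proof -
    obtain x y where xy: "x \<in> D" "x \<in> K" "y \<in> D" "y \<in> M"
      using D assms unfolding scott_open_filter_def by blast
    then obtain z where "z \<in> D" "x \<le> z" "y \<le> z"
      using D(1) unfolding directed_def by blast
    then show ?thesis
      using xy assms lattice_filterD unfolding scott_open_filter_def by blast
  qed
  moreover have "lattice_filter (K \<inter> M)"
  proof -
    have "lattice_filter K" "lattice_filter M"
      using assms unfolding scott_open_filter_def by simp_all
    then have "Inf A \<in> K \<inter> M" if "finite A" "A \<subseteq> K \<inter> M" for A
      using that unfolding lattice_filter_def by simp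
    moreover have "y \<in> K \<inter> M" if "x \<in> K \<inter> M" "x \<le> y" for x y
      using that lattice_filterD[OF \<open>lattice_filter K\<close>] lattice_filterD[OF \<open>lattice_filter M\<close>]
      by (metis Int_iff)
    ultimately show ?thesis
      unfolding lattice_filter_def by (intro conjI ballI allI impI)
  qed
  ultimately show ?thesis
    unfolding scott_open_filter_def by blast
qed

typedef (overloaded) 'a scott_filter = "{K :: 'a::frame set. scott_open_filter K}"
  morphisms filter_set Abs_scott_filter
  using scott_open_filter_UNIV by blast

text \<open>Reverse inclusion.\<close>

instantiation scott_filter :: (frame) order
begin

definition less_eq_scott_filter :: "'a scott_filter \<Rightarrow> 'a scott_filter \<Rightarrow> bool" where
  "F \<le> G \<longleftrightarrow> filter_set G \<subseteq> filter_set F"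

definition less_scott_filter :: "'a scott_filter \<Rightarrow> 'a scott_filter \<Rightarrow> bool" where
  "F < G \<longleftrightarrow> filter_set G \<subset> filter_set F"

instance
  by standard
    (auto simp: less_eq_scott_filter_def less_scott_filter_def filter_set_inject)

end

text \<open>
  All finite joins and filtered meets of Scott-open filters exist, and they are intersections
  (the empty one being \<open>UNIV\<close>) and unions, respectively.  So the quantifiers over \<open>x\<close> in
  \<open>co_preframe_hom\<close> range over an existing element when the domain is \<open>'a scott_filter\<close>.
\<close>

lemma filter_set_scott_open: "scott_open_filter (filter_set F)"
  using filter_set by blast

lemma scott_open_filter_INT:
  assumes "finite A"
  shows "scott_open_filter (\<Inter>F\<in>A. filter_set F)"
  using assms
proof induction
  case empty
  then show ?case by (simp add: scott_open_filter_UNIV)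
next
  case (insert F A)
  then show ?case by (simp add: scott_open_filter_Int filter_set_scott_open)
qed

lemma filtered_finite_lower_bound:
  assumes "filtered A" "finite B" "B \<subseteq> A"
  shows "\<exists>G\<in>A. \<forall>F\<in>B. G \<le> F"
  using assms(2,3)
proof induction
  case empty
  then show ?case using assms(1) unfolding filtered_def by blast
next
  case (insert F B)
  then obtain G where G: "G \<in> A" "\<forall>F\<in>B. G \<le> F" by blast
  obtain H where "H \<in> A" "H \<le> G" "H \<le> F"
    using assms(1) G(1) insert.prems unfolding filtered_def by blast
  with G(2) show ?case by (intro bexI[of _ H]) (auto intro: order_trans)
qed

lemma scott_open_filter_UN:
  fixes A :: "'a::frame scott_filter set"
  assumes A: "filtered A"
  shows "scott_open_filter (\<Union>F\<in>A. filter_set F)"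
proof -
  let ?U = "\<Union>F\<in>A. filter_set F"
  have open_F: "scott_open_filter (filter_set F)" for F :: "'a scott_filter"
    by (rule filter_set_scott_open)
  have "Inf X \<in> ?U" if X: "finite X" "X \<subseteq> ?U" for X
  proof -
    obtain g where g: "\<forall>x\<in>X. g x \<in> A \<and> x \<in> filter_set (g x)"
      using X(2) by (metis UN_E subsetD)
    then obtain G where G: "G \<in> A" "\<forall>F\<in>g ` X. G \<le> F"
      using filtered_finite_lower_bound[OF A, of "g ` X"] X(1) by blast
    then have "X \<subseteq> filter_set G"
      using g unfolding less_eq_scott_filter_def by blast
    then have "Inf X \<in> filter_set G"
      using open_F[of G] X(1) unfolding scott_open_filter_def lattice_filter_def by blast
    then show ?thesis using G(1) by blast
  qed
  moreover have "y \<in> ?U" if U: "x \<in> ?U" "x \<le> y" for x y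
  proof -
    obtain F where F: "F \<in> A" "x \<in> filter_set F" using U(1) by blast
    then have "y \<in> filter_set F"
      using open_F[of F] lattice_filterD U(2) unfolding scott_open_filter_def by blast
    with F(1) show ?thesis by blast
  qed
  moreover have "\<exists>d\<in>D. d \<in> ?U" if U: "directed D" "Sup D \<in> ?U" for D
  proof -
    obtain F where F: "F \<in> A" "Sup D \<in> filter_set F" using U(2) by blast
    then have "\<exists>d\<in>D. d \<in> filter_set F"
      using open_F[of F] U(1) unfolding scott_open_filter_def by blast
    with F(1) show ?thesis by blast
  qed
  ultimately show ?thesis
    unfolding scott_open_filter_def lattice_filter_def by simp
qed

lemma isLub_Abs_scott_filter:
  assumes "finite A"
  shows "isLub UNIV A (Abs_scott_filter (\<Inter>F\<in>A. filter_set F))"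
  using Abs_scott_filter_inverse[of "\<Inter>F\<in>A. filter_set F"] scott_open_filter_INT[OF assms]
  unfolding isLub_def leastP_def isUb_def setle_def setge_def less_eq_scott_filter_def
  by auto

lemma isGlb_Abs_scott_filter:
  assumes "filtered A"
  shows "isGlb UNIV A (Abs_scott_filter (\<Union>F\<in>A. filter_set F))"
  using Abs_scott_filter_inverse[of "\<Union>F\<in>A. filter_set F"] scott_open_filter_UN[OF assms]
  unfolding isGlb_def greatestP_def isLb_def setle_def setge_def less_eq_scott_filter_def
  by auto

definition ext_hat :: "('a::frame \<Rightarrow> 'b::complete_lattice) \<Rightarrow> 'a scott_filter \<Rightarrow> 'b" where
  "ext_hat e K = Inf (e ` filter_set K)"

definition canonical_extension :: "('a::frame \<Rightarrow> 'b::complete_lattice) \<Rightarrow> bool" where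
  "canonical_extension e \<longleftrightarrow>
     mono e \<and>
     (\<forall>u v. (\<forall>K a. ext_hat e K \<le> u \<longrightarrow> v \<le> e a \<longrightarrow> ext_hat e K \<le> e a) \<longrightarrow> u \<le> v) \<and>
     (\<forall>K a. ext_hat e K \<le> e a \<longrightarrow> a \<in> filter_set K)"

end

theory Submission
  imports Defs
begin

text \<open>
  Write \<open>k\<close> for \<open>ext_hat e\<close>. Compactness says \<open>k K \<le> e a \<longleftrightarrow> a \<in> K\<close>, and density says that the
  elements \<open>k K\<close> are join-dense and the elements \<open>e a\<close> meet-dense. Hence every inequality in the
  extension can be tested on these elements, where it becomes a statement about membership in
  Scott-open filters. Injectivity in the locally compact case holds because Scott-open filters
  separate points: interpolating \<open>c \<lless> a\<close> repeatedly gives a descending chain between \<open>c\<close> and \<open>a\<close>,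
  and the up-closure of this chain is a Scott-open filter.
\<close>

section \<open>Way-below and separation of points by Scott-open filters\<close>

lemma way_below_imp_le:
  assumes "way_below c a"
  shows "c \<le> a"
proof -
  have "directed {a}" by (simp add: directed_def)
  then show ?thesis using assms unfolding way_below_def by fastforce
qed

lemma way_below_le_trans: "way_below c a \<Longrightarrow> a \<le> b \<Longrightarrow> way_below c b"
  unfolding way_below_def by (blast intro: order_trans)

lemma le_way_below_trans: "c \<le> b \<Longrightarrow> way_below b a \<Longrightarrow> way_below c a"
  unfolding way_below_def by (blast intro: order_trans)

text \<open>Approximating \<open>a\<close> and then its approximants shows that the elements
  \<open>x\<close> with x \<lless> y \<lless> a for some \<open>y\<close> form a directed set with
  join above \<open>a\<close>. Since c \<lless> a, one of them lies above \<open>c\<close>.\<close>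

lemma way_below_interpolate:
  fixes a c :: "'a::frame"
  assumes lc: "locally_compact_frame TYPE('a)" and "way_below c a"
  obtains y where "way_below c y" "way_below y a"
proof -
  have dir: "directed {c. way_below c b}" and approx: "b = Sup {c. way_below c b}" for b :: 'a
    using lc unfolding locally_compact_frame_def by blast+
  let ?D = "{x. \<exists>y. way_below x y \<and> way_below y a}"
  have "directed ?D"
    unfolding directed_def
  proof (intro conjI ballI)
    have "{c. way_below c b} \<noteq> {}" for b :: 'a
      using dir[of b] by (simp add: directed_def)
    then show "?D \<noteq> {}" by blast
  next
    fix x1 x2 assume "x1 \<in> ?D" "x2 \<in> ?D"
    then obtain y1 y2 where x: "way_below x1 y1" "way_below x2 y2"
      and y: "way_below y1 a" "way_below y2 a" by blast
    obtain y where "way_below y a" "y1 \<le> y" "y2 \<le> y"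
      using dir[of a] y unfolding directed_def by blast
    moreover from this x have "way_below x1 y" "way_below x2 y"
      by (blast intro: way_below_le_trans)+
    then obtain z where "way_below z y" "x1 \<le> z" "x2 \<le> z"
      using dir[of y] unfolding directed_def by blast
    ultimately show "\<exists>z\<in>?D. x1 \<le> z \<and> x2 \<le> z" by blast
  qed
  moreover have "a \<le> Sup ?D"
  proof -
    have "y \<le> Sup ?D" if "way_below y a" for y
    proof -
      have "Sup {x. way_below x y} \<le> Sup ?D"
        using that by (intro Sup_subset_mono) blast
      then show ?thesis by (simp only: approx[symmetric])
    qed
    then have "Sup {y. way_below y a} \<le> Sup ?D" by (intro Sup_least) blast
    then show ?thesis by (simp only: approx[symmetric])
  qed
  ultimately obtain x y where "c \<le> x" "way_below x y" "way_below y a"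
    using assms(2) unfolding way_below_def[of c a] by blast
  then show thesis using that le_way_below_trans by blast
qed

text \<open>The chain descends, so two of its members have the later one as a common lower bound;
  this gives finite meets. A directed set with join above \<open>f n\<close> has a member above
  \<open>f (Suc n)\<close>; this gives openness.\<close>

lemma scott_open_filter_way_below_chain:
  fixes f :: "nat \<Rightarrow> 'a::complete_lattice"
  assumes chain: "\<And>n. way_below (f (Suc n)) (f n)"
  shows "scott_open_filter {x. \<exists>n. f n \<le> x}"
proof -
  let ?K = "{x. \<exists>n. f n \<le> x}"
  have "antimono f"
    by (simp add: antimono_iff_le_Suc chain way_below_imp_le)
  have "Inf A \<in> ?K" if "finite A" "A \<subseteq> ?K" for A
    using that
  proof (induction A)
    case (insert x A)
    then obtain m n where "f m \<le> x" "f n \<le> Inf A" by auto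
    then have "f (max m n) \<le> Inf (insert x A)"
      using antimonoD[OF \<open>antimono f\<close>, of m "max m n"]
        antimonoD[OF \<open>antimono f\<close>, of n "max m n"]
      by (auto intro: order_trans)
    then show ?case by blast
  qed simp
  moreover have "\<exists>d\<in>D. d \<in> ?K" if "directed D" "Sup D \<in> ?K" for D
    using that chain unfolding way_below_def by blast
  ultimately show ?thesis
    unfolding scott_open_filter_def lattice_filter_def by (auto intro: order_trans)
qed

lemma scott_open_filter_separates:
  fixes a b :: "'a::frame"
  assumes lc: "locally_compact_frame TYPE('a)" and "\<not> a \<le> b"
  obtains K where "a \<in> filter_set K" "b \<notin> filter_set K"
proof -
  have "a = Sup {c. way_below c a}"
    using lc unfolding locally_compact_frame_def by blast
  then obtain c where c: "way_below c a" "\<not> c \<le> b"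
    using assms(2) by (metis (mono_tags, lifting) Sup_least mem_Collect_eq)
  \<comment> \<open>The invariant \<open>way_below c (f n)\<close> allows the next interpolation. It
    also puts \<open>c\<close> below the whole chain, so \<open>b\<close> in the generated filter
    would give c \<le> b.\<close>
  have "\<exists>f. \<forall>n. (way_below c (f n) \<and> f n \<le> a) \<and> way_below (f (Suc n)) (f n)"
  proof (rule dependent_nat_choice)
    show "\<exists>x. way_below c x \<and> x \<le> a" using c(1) by blast
  next
    fix x assume "way_below c x \<and> x \<le> a"
    then show "\<exists>y. (way_below c y \<and> y \<le> a) \<and> way_below y x"
      by (meson lc way_below_interpolate way_below_imp_le order_trans)
  qed
  then obtain f where f: "\<And>n. way_below c (f n)" "\<And>n. f n \<le> a"
    "\<And>n. way_below (f (Suc n)) (f n)" by blast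
  let ?K = "{x. \<exists>n. f n \<le> x}"
  have "filter_set (Abs_scott_filter ?K) = ?K"
    using scott_open_filter_way_below_chain[of f, OF f(3)] by (simp add: Abs_scott_filter_inverse)
  moreover have "a \<in> ?K" using f(2) by blast
  moreover have "b \<notin> ?K" using f(1) c(2) way_below_imp_le order_trans by blast
  ultimately show thesis using that by metis
qed

section \<open>Membership, joins and meets of Scott-open filters\<close>

lemma filter_set_Inf_mem: "finite A \<Longrightarrow> A \<subseteq> filter_set K \<Longrightarrow> Inf A \<in> filter_set K"
  using filter_set_scott_open unfolding scott_open_filter_def lattice_filter_def by blast

lemma filter_set_Sup_memE:
  assumes "directed D" "Sup D \<in> filter_set K"
  obtains d where "d \<in> D" "d \<in> filter_set K"
  using filter_set_scott_open[of K] assms unfolding scott_open_filter_def by blast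

text \<open>Least upper bounds are unique, so \<open>x\<close> is the one built from the
  intersection.\<close>

lemma filter_set_isLub:
  assumes "finite A" "isLub UNIV A x"
  shows "filter_set x = (\<Inter>F\<in>A. filter_set F)"
proof -
  note lub = isLub_Abs_scott_filter[OF assms(1)]
  have "x = Abs_scott_filter (\<Inter>F\<in>A. filter_set F)"
    using isLub_le_isUb[OF assms(2) isLub_isUb[OF lub]]
      isLub_le_isUb[OF lub isLub_isUb[OF assms(2)]]
    by (rule antisym)
  then show ?thesis
    using scott_open_filter_INT[OF assms(1)] by (simp add: Abs_scott_filter_inverse)
qed

lemma filter_set_isGlb:
  assumes "filtered A" "isGlb UNIV A x"
  shows "filter_set x = (\<Union>F\<in>A. filter_set F)"
proof -
  note glb = isGlb_Abs_scott_filter[OF assms(1)]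
  have "x = Abs_scott_filter (\<Union>F\<in>A. filter_set F)"
    using isGlb_le_isLb[OF glb isGlb_isLb[OF assms(2)]]
      isGlb_le_isLb[OF assms(2) isGlb_isLb[OF glb]]
    by (rule antisym)
  then show ?thesis
    using scott_open_filter_UN[OF assms(1)] by (simp add: Abs_scott_filter_inverse)
qed

section \<open>Consequences of density and compactness\<close>

context
  fixes e :: "'a::frame \<Rightarrow> 'b::complete_lattice"
  assumes ext: "canonical_extension e"
begin

lemma canonical_extension_mono: "mono e"
  using ext unfolding canonical_extension_def by blast

lemma ext_hat_le_iff: "ext_hat e K \<le> e a \<longleftrightarrow> a \<in> filter_set K"
proof
  show "ext_hat e K \<le> e a \<Longrightarrow> a \<in> filter_set K"
    using ext unfolding canonical_extension_def by blast
  show "a \<in> filter_set K \<Longrightarrow> ext_hat e K \<le> e a"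
    unfolding ext_hat_def by (rule INF_lower)
qed

lemma canonical_extension_leI:
  "(\<And>K a. ext_hat e K \<le> u \<Longrightarrow> v \<le> e a \<Longrightarrow> ext_hat e K \<le> e a) \<Longrightarrow> u \<le> v"
  using ext unfolding canonical_extension_def by blast

lemma canonical_extension_eq_Inf: "u = Inf {e a | a. u \<le> e a}"
proof (rule antisym)
  show "u \<le> Inf {e a | a. u \<le> e a}" by (auto intro: Inf_greatest)
  show "Inf {e a | a. u \<le> e a} \<le> u"
  proof (rule canonical_extension_leI)
    fix K a assume "ext_hat e K \<le> Inf {e a | a. u \<le> e a}" "u \<le> e a"
    then show "ext_hat e K \<le> e a" by (auto simp: le_Inf_iff)
  qed
qed

lemma canonical_extension_eq_Sup: "u = Sup {ext_hat e K | K. ext_hat e K \<le> u}"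
proof (rule antisym)
  show "Sup {ext_hat e K | K. ext_hat e K \<le> u} \<le> u" by (auto intro: Sup_least)
  show "u \<le> Sup {ext_hat e K | K. ext_hat e K \<le> u}"
  proof (rule canonical_extension_leI)
    fix K a assume "ext_hat e K \<le> u" "Sup {ext_hat e K | K. ext_hat e K \<le> u} \<le> e a"
    then show "ext_hat e K \<le> e a" by (auto simp: Sup_le_iff)
  qed
qed

text \<open>Join-density: inequalities can be tested from below on the elements
  \<open>ext_hat e K\<close>.\<close>

lemma le_if_ext_hat_le:
  assumes "\<And>K. ext_hat e K \<le> u \<Longrightarrow> ext_hat e K \<le> v"
  shows "u \<le> v"
  by (rule canonical_extension_leI) (rule order_trans[OF assms])

text \<open>Meet-density: inequalities can be tested from above on the elements
  \<open>e a\<close>.\<close>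

lemma le_if_le_canonical_extension:
  assumes "\<And>a. v \<le> e a \<Longrightarrow> u \<le> e a"
  shows "u \<le> v"
  by (rule canonical_extension_leI) (rule order_trans[OF _ assms])

text \<open>Tested on \<open>ext_hat e K\<close>, the nontrivial inequality says that
  \<open>K\<close> is closed under finite meets.\<close>

lemma canonical_extension_Inf:
  assumes "finite A"
  shows "e (Inf A) = Inf (e ` A)"
proof (rule antisym)
  show "e (Inf A) \<le> Inf (e ` A)"
    by (rule mono_Inf[OF canonical_extension_mono])
  show "Inf (e ` A) \<le> e (Inf A)"
  proof (rule le_if_ext_hat_le)
    fix K assume "ext_hat e K \<le> Inf (e ` A)"
    then have "A \<subseteq> filter_set K" by (auto simp: le_Inf_iff ext_hat_le_iff)
    then show "ext_hat e K \<le> e (Inf A)"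
      by (simp add: ext_hat_le_iff filter_set_Inf_mem assms)
  qed
qed

text \<open>Tested on \<open>ext_hat e K\<close>, the nontrivial inequality is Scott-openness of
  \<open>K\<close>.\<close>

lemma canonical_extension_Sup_directed:
  assumes "directed D"
  shows "e (Sup D) = Sup (e ` D)"
proof (rule antisym)
  show "Sup (e ` D) \<le> e (Sup D)"
    by (rule mono_Sup[OF canonical_extension_mono])
  show "e (Sup D) \<le> Sup (e ` D)"
  proof (rule le_if_ext_hat_le)
    fix K assume "ext_hat e K \<le> e (Sup D)"
    then obtain d where "d \<in> D" "ext_hat e K \<le> e d"
      using filter_set_Sup_memE[OF assms] by (metis ext_hat_le_iff)
    then show "ext_hat e K \<le> Sup (e ` D)" by (blast intro: order_trans Sup_upper)
  qed
qed

lemma canonical_extension_bot: "e bot = bot"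
proof -
  have "e bot \<le> bot"
  proof (rule canonical_extension_leI)
    fix K a assume "ext_hat e K \<le> e bot"
    \<comment> \<open>By compactness \<open>K\<close> contains \<open>bot\<close>, so it is the
      improper filter.\<close>
    then have "a \<in> filter_set K"
      using filter_set_scott_open[of K] lattice_filterD[of "filter_set K" bot a]
      by (simp add: ext_hat_le_iff scott_open_filter_def)
    then show "ext_hat e K \<le> e a" by (simp add: ext_hat_le_iff)
  qed
  then show ?thesis by (simp add: bot_unique)
qed

lemma inj_ext_hat: "inj (ext_hat e)"
proof (rule injI)
  fix K M assume "ext_hat e K = ext_hat e M"
  then have "filter_set K = filter_set M"
    by (metis ext_hat_le_iff set_eqI)
  then show "K = M" by (simp add: filter_set_inject)
qed

text \<open>By compactness, \<open>e a\<close> bounds every \<open>ext_hat e F\<close> with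
  \<open>F\<close> in \<open>A\<close> exactly when \<open>a\<close> lies in the intersection of
  these filters, which is \<open>x\<close>.\<close>

lemma ext_hat_isLub:
  assumes "finite A" "isLub UNIV A x"
  shows "ext_hat e x = Sup (ext_hat e ` A)"
proof -
  note x = filter_set_isLub[OF assms]
  have "ext_hat e x \<le> Sup (ext_hat e ` A)"
    by (rule le_if_le_canonical_extension) (simp add: Sup_le_iff ext_hat_le_iff x)
  moreover have "ext_hat e F \<le> ext_hat e x" if "F \<in> A" for F
    unfolding ext_hat_def x using that by (intro Inf_superset_mono) blast
  then have "Sup (ext_hat e ` A) \<le> ext_hat e x" by (auto intro: Sup_least)
  ultimately show ?thesis by (rule antisym)
qed

text \<open>The filter \<open>x\<close> is the union of \<open>A\<close>, and an infimum over a
  union is the infimum of the infima.\<close>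

lemma ext_hat_isGlb:
  assumes "filtered A" "isGlb UNIV A x"
  shows "ext_hat e x = Inf (ext_hat e ` A)"
  unfolding ext_hat_def filter_set_isGlb[OF assms]
proof (rule antisym)
  show "(INF a\<in>(\<Union>F\<in>A. filter_set F). e a) \<le> (INF F\<in>A. INF a\<in>filter_set F. e a)"
    by (intro INF_greatest INF_lower UN_I)
  show "(INF F\<in>A. INF a\<in>filter_set F. e a) \<le> (INF a\<in>(\<Union>F\<in>A. filter_set F). e a)"
    by (rule INF_greatest) (elim UN_E, rule INF_lower2, assumption, rule INF_lower)
qed

lemma canonical_extension_frame_hom:
  assumes "inj e"
  shows "frame_hom e"
proof -
  \<comment> \<open>Preservation of binary meets turns injectivity into order reflection, which lets
    upper bounds \<open>e c\<close> of the image be pulled back to upper bounds \<open>c\<close> of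
    \<open>A\<close>.\<close>
  have reflect: "a \<le> c" if "e a \<le> e c" for a c
  proof -
    have "e (inf a c) = e a"
      using that canonical_extension_Inf[of "{a, c}"] by (simp add: inf_absorb1)
    then show ?thesis using assms by (metis injD inf.absorb_iff1)
  qed
  have "e (Sup A) = Sup (e ` A)" for A
  proof (rule antisym)
    show "Sup (e ` A) \<le> e (Sup A)"
      by (rule mono_Sup[OF canonical_extension_mono])
    show "e (Sup A) \<le> Sup (e ` A)"
    proof (rule le_if_le_canonical_extension)
      fix c assume "Sup (e ` A) \<le> e c"
      then have "Sup A \<le> c" by (auto simp: Sup_le_iff reflect)
      then show "e (Sup A) \<le> e c" by (rule monoD[OF canonical_extension_mono])
    qed
  qed
  then show ?thesis by (simp add: frame_hom_def canonical_extension_Inf)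
qed

text \<open>By compactness \<open>e a\<close> determines which Scott-open filters contain
  \<open>a\<close>, and these filters separate points.\<close>

lemma canonical_extension_inj:
  assumes "locally_compact_frame TYPE('a)"
  shows "inj e"
proof (rule injI)
  have "a \<le> b" if "e a = e b" for a b
    using that scott_open_filter_separates[OF assms, of a b] by (metis ext_hat_le_iff)
  then show "a = b" if "e a = e b" for a b
    using that by (metis antisym)
qed

end

theorem proposition3p6:
  fixes e :: "'a::frame \<Rightarrow> 'b::complete_lattice"
  assumes "canonical_extension e"
  shows "(preframe_hom e \<and> e bot = bot) \<and>
    (inj (ext_hat e) \<and> co_preframe_hom (ext_hat e)) \<and>
    (\<forall>u. u = Inf {e a | a. u \<le> e a} \<and> u = Sup {ext_hat e K | K. ext_hat e K \<le> u}) \<and>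
    (inj e \<longrightarrow> frame_hom e) \<and>
    (locally_compact_frame TYPE('a) \<longrightarrow> inj e \<and> frame_hom e)"
proof (intro conjI allI impI)
  show "preframe_hom e"
    using assms
    by (simp add: preframe_hom_def canonical_extension_Sup_directed canonical_extension_Inf)
  show "co_preframe_hom (ext_hat e)"
    using assms by (simp add: co_preframe_hom_def ext_hat_isLub ext_hat_isGlb)
  show "u = Inf {e a | a. u \<le> e a}" for u
    by (rule canonical_extension_eq_Inf[OF assms])
  show "u = Sup {ext_hat e K | K. ext_hat e K \<le> u}" for u
    by (rule canonical_extension_eq_Sup[OF assms])
qed (simp_all add: assms canonical_extension_bot inj_ext_hat canonical_extension_frame_hom
  canonical_extension_inj)

end
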